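(* For all real $\beta<1$ sufficiently close to $1$ we have $r_6(\beta)<r_4(\beta)$.
   Context: For an integer $n\ge2$ and real $\beta$ with $0\le\beta\le1$, $S(n,\beta)$ is the set of complex polynomials of degree $n$ with all roots in the closed unit disk and at least one root at $\beta$. For a polynomial $P$, $|P|_\beta$ is the distance between $\beta$ and the closest root of the derivative $P'$. Define $r_n(\beta)=\sup\{|P|_\beta: P\in S(n,\beta)\}$. *)

theory Defs
  imports "HOL-Analysis.Analysis" "HOL-Computational_Algebra.Polynomial"
begin

definition S :: "nat \<Rightarrow> real \<Rightarrow> complex poly set" where
  "S n \<beta> = {P. degree P = n \<and> (\<forall>z. poly P z = 0 \<longrightarrow> norm z \<le> 1) \<and>
                poly P (complex_of_real \<beta>) = 0}"

(* For degree P \<ge> 2 the set of critical points is finite and nonempty, so the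
   infimum in infdist is attained at a closest critical point. *)
definition crit_dist :: "real \<Rightarrow> complex poly \<Rightarrow> real" where
  "crit_dist \<beta> P = infdist (complex_of_real \<beta>) {z. poly (pderiv P) z = 0}"

(* For n \<ge> 2 and 0 \<le> \<beta> \<le> 1 the set S n \<beta> is nonempty (it contains (x - \<beta>)^n), and by
   Gauss-Lucas crit_dist \<beta> is bounded by 2 on it, so this is a genuine supremum. *)
definition r :: "nat \<Rightarrow> real \<Rightarrow> real" where
  "r n \<beta> = (SUP P\<in>S n \<beta>. crit_dist \<beta> P)"

end

theory Submission
  imports Defs "HOL-Library.Landau_Symbols" "HOL-Computational_Algebra.Fundamental_Theorem_Algebra"
begin

text \<open>
  Put $x = 1 - \beta$. To first order in $x$ one has $r_4(\beta) = 1 - x/3$ and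
  $r_6(\beta) = 1 - 11x/30$, and $1/3 < 11/30$. It is enough to separate the two functions by rates
  strictly between these numbers: $r_4(\beta) \geq 1 - 17x/50$ and $r_6(\beta) \leq 1 - 7x/20$.

  The bound for degree four is an explicit polynomial (\<open>quartic_witness\<close>): besides $\beta$ it has the
  root $-1$ and a conjugate pair on the unit circle, so its roots are as far out as possible, and the
  angle of the pair is tuned so that the derivative factors.

  For degree six, suppose that all critical points of $P$ are further than $1 - 7x/20$ from $\beta$.
  Translate so that the distinguished root becomes $1$, and write the critical points $\eta_j$ as
  $1/(1 - \eta_j) = 1 + a_j$. The hypothesis is then an upper bound on $|1 + a_j|$. In the other
  direction, comparing $P''/P'$ at the root with the roots $u_k$ gives
  $\sum 1/(1 - \eta_j) = 2 \sum 1/(1 - u_k)$, and since the $u_k$ stay away from $1$ and lie in a disk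
  almost through $1$, each term $1/(1 - u_k)$ has real part at least about $1/2$. Both bounds together leave room only for
  $\mathrm{Re}\, a_j = O(x)$ and $\mathrm{Im}\, a_j = O(\sqrt x)$ (\<open>sextic_critical_coefficients\<close>).

  Up to a constant, $P$ is the primitive of $\prod (u - a_j (1 - u))$, a perturbation of
  $(u^6 - 1)/6$. Let $s_1, s_2$ be the first two elementary symmetric functions of the $a_j$. The root
  near a sixth root of unity $w$ may not leave the disk, which to first order in $x$ is a linear
  inequality in $s_1$ and $s_2$. The roots near the two primitive cube roots of unity force
  $s_1 = O(x)$, and then $2\,\mathrm{Re}\, s_2 = \sum |a_j|^2$ up to $O(x^{3/2})$. With
  $p = \mathrm{Re}\, s_1$ and $B = \sum |a_j|^2$ the inequalities at $w = -1$ and at the cube roots of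
  unity become, up to $O(x^{3/2})$,
  \[ \frac25 p + \frac25 B \geq x, \qquad \frac35 p + \frac9{40} B \geq x. \]
  The first plus $8/3$ times the second is $2p + B \geq 11x/3$, whereas the bounds on $|1 + a_j|$ sum
  to $2p + B \leq 7x/2 + O(x^2)$. This is impossible for small $x$
  (\<open>no_uniformly_far_critical_points\<close>).
\<close>

section \<open>Perturbations of $u^{n+1} - 1$ with a fixed root at 1\<close>

text \<open>
  The elementary symmetric function of degree $m$ in $a_0, \dots, a_{n-1}$, given by its recursion in
  $n$ so that all facts about it are inductions.
\<close>
fun esym :: "(nat \<Rightarrow> complex) \<Rightarrow> nat \<Rightarrow> nat \<Rightarrow> complex" where
  "esym a n 0 = 1"
| "esym a 0 (Suc m) = 0"
| "esym a (Suc n) (Suc m) = esym a n (Suc m) + a n * esym a n m"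

lemma esym_eq_0: "n < m \<Longrightarrow> esym a n m = 0"
  by (induction a n m rule: esym.induct) auto

lemma esym_1: "esym a n 1 = (\<Sum>j<n. a j)"
  by (induction n) auto

lemma esym_2: "2 * esym a n 2 = (\<Sum>j<n. a j)\<^sup>2 - (\<Sum>j<n. (a j)\<^sup>2)"
proof (induction n)
  case (Suc n)
  have "2 * esym a (Suc n) 2 = 2 * esym a n 2 + 2 * a n * esym a n 1"
    by (simp add: numeral_2_eq_2 algebra_simps)
  with Suc show ?case by (simp add: esym_1[simplified] power2_eq_square algebra_simps)
qed (simp add: numeral_2_eq_2)

lemma prod_diff_esym:
  "(\<Prod>j<n. x - a j * y) = (\<Sum>m\<le>n. (- 1) ^ m * esym a n m * y ^ m * x ^ (n - m))"
proof (induction n)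
  case (Suc n)
  let ?f = "\<lambda>m. (- 1) ^ m * esym a n m * y ^ m"
  have *: "(- 1) ^ Suc m * esym a (Suc n) (Suc m) * y ^ Suc m * x ^ (n - m)
     = ?f (Suc m) * x ^ (n - m) - ?f m * x ^ (n - m) * (a n * y)" for m
    by (simp add: algebra_simps)
  have "(\<Sum>m\<le>Suc n. (- 1) ^ m * esym a (Suc n) m * y ^ m * x ^ (Suc n - m))
    = x ^ Suc n + (\<Sum>m\<le>n. ?f (Suc m) * x ^ (n - m)) - (\<Sum>m\<le>n. ?f m * x ^ (n - m)) * (a n * y)"
    unfolding sum.atMost_Suc_shift diff_Suc_Suc * sum_subtractf sum_distrib_right by simp
  also have "x ^ Suc n + (\<Sum>m\<le>n. ?f (Suc m) * x ^ (n - m)) = (\<Sum>m\<le>Suc n. ?f m * x ^ (Suc n - m))"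
    unfolding sum.atMost_Suc_shift[of _ n] by simp
  also have "\<dots> = (\<Sum>m\<le>n. ?f m * x ^ (n - m)) * x"
    unfolding sum_distrib_right by (simp add: esym_eq_0 Suc_diff_le mult_ac)
  finally show ?case using Suc by (simp add: algebra_simps)
qed simp

text \<open>
  The incomplete Beta integral $\int_1^u t^{n-m} (1-t)^m\,dt$, expanded by the binomial theorem.
\<close>
definition beta_primitive :: "nat \<Rightarrow> nat \<Rightarrow> complex \<Rightarrow> complex" where
  "beta_primitive n m u =
    (\<Sum>i\<le>m. of_nat (m choose i) * (- 1) ^ i * ((u ^ Suc (n - m + i) - 1) / of_nat (Suc (n - m + i))))"

lemma beta_primitive_1 [simp]: "beta_primitive n m 1 = 0"
  by (simp add: beta_primitive_def)

lemma beta_primitive_deriv: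
  "(beta_primitive n m has_field_derivative u ^ (n - m) * (1 - u) ^ m) (at u)"
proof -
  have *: "((\<lambda>u. (u ^ Suc k - 1) / of_nat (Suc k)) has_field_derivative u ^ k) (at u)" for k and u :: complex
    by (rule derivative_eq_intros refl | simp add: divide_simps del: of_nat_Suc)+
  have "(1 - u) ^ m = (\<Sum>i\<le>m. of_nat (m choose i) * (- 1) ^ i * u ^ i)"
    using binomial_ring[of "- u" 1 m] by (simp add: power_minus' mult_ac flip: power_minus)
  then have "u ^ (n - m) * (1 - u) ^ m = (\<Sum>i\<le>m. of_nat (m choose i) * (- 1) ^ i * u ^ (n - m + i))"
    by (simp add: sum_distrib_left power_add mult_ac)
  then show ?thesis unfolding beta_primitive_def by (simp only:) (intro DERIV_sum DERIV_cmult *)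
qed

text \<open>
  The polynomial of degree $n + 1$ with a root at $1$ and derivative $\prod_j (u - a_j (1 - u))$; it is
  $(u^{n+1} - 1)/(n+1)$ when all $a_j$ vanish. Expanding it in symmetric functions of the $a_j$ sorts
  its terms by their order in a small parameter.
\<close>
definition perturbed_primitive :: "nat \<Rightarrow> (nat \<Rightarrow> complex) \<Rightarrow> complex \<Rightarrow> complex" where
  "perturbed_primitive n a u = (\<Sum>m\<le>n. (- 1) ^ m * esym a n m * beta_primitive n m u)"

lemma perturbed_primitive_1 [simp]: "perturbed_primitive n a 1 = 0"
  by (simp add: perturbed_primitive_def)

lemma perturbed_primitive_deriv:
  "(perturbed_primitive n a has_field_derivative (\<Prod>j<n. u - a j * (1 - u))) (at u)"
proof -
  have "(\<Prod>j<n. u - a j * (1 - u)) = (\<Sum>m\<le>n. (- 1) ^ m * esym a n m * (u ^ (n - m) * (1 - u) ^ m))"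
    unfolding prod_diff_esym by (simp add: mult_ac)
  then show ?thesis
    unfolding perturbed_primitive_def by (simp only:) (intro DERIV_sum DERIV_cmult beta_primitive_deriv)
qed

text \<open>
  The terms up to degree two in the $a_j$ are kept apart from the tail, since only they matter to
  first order in $1 - \beta$.
\<close>
lemma perturbed_primitive_5:
  "perturbed_primitive 5 a u = (u ^ 6 - 1) / 6
     - (esym a 5 1 * beta_primitive 5 1 u - esym a 5 2 * beta_primitive 5 2 u
        - (\<Sum>m\<in>{3..5}. (- 1) ^ m * esym a 5 m * beta_primitive 5 m u))"
proof -
  have "{..5} = insert 0 (insert 1 (insert 2 {3..5::nat}))" by auto
  moreover have "beta_primitive 5 0 u = (u ^ 6 - 1) / 6" by (simp add: beta_primitive_def)
  ultimately show ?thesis unfolding perturbed_primitive_def by simp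
qed

lemma beta_primitive_5_1: "w ^ 6 = 1 \<Longrightarrow> beta_primitive 5 1 w = (w ^ 5 - 1) / 5"
  by (simp add: beta_primitive_def)

lemma beta_primitive_5_2: "w ^ 6 = 1 \<Longrightarrow> beta_primitive 5 2 w = (w ^ 4 - 1) / 4 - 2 * (w ^ 5 - 1) / 5"
  by (simp add: beta_primitive_def numeral_2_eq_2 field_simps)

section \<open>Orders of magnitude in a small parameter\<close>

text \<open>
  The small parameter \<open>e\<close> stands for $\sqrt{1 - \beta}$, because this is the scale of the critical
  points. The filter is left open: in the application it will be the left neighbourhoods of $1$
  restricted to the parameters at which a bound fails, and the goal is to show that it is trivial.
\<close>
locale small_parameter =
  fixes F :: "'t filter" and e :: "'t \<Rightarrow> real"
  assumes e_tendsto_0: "(e \<longlongrightarrow> 0) F" and e_pos: "\<forall>\<^sub>F t in F. 0 < e t"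
begin

text \<open>
  The classes $O(e^k)$ for complex and for real functions; two copies are needed since a Landau class
  has a single value type.
\<close>
abbreviation Oc :: "nat \<Rightarrow> ('t \<Rightarrow> complex) set" where
  "Oc k \<equiv> O[F](\<lambda>t. complex_of_real (e t) ^ k)"

abbreviation Or :: "nat \<Rightarrow> ('t \<Rightarrow> real) set" where
  "Or k \<equiv> O[F](\<lambda>t. e t ^ k)"

lemma Oc_iff_norm: "f \<in> Oc k \<longleftrightarrow> (\<lambda>t. norm (f t)) \<in> Or k"
  unfolding bigo_def by (simp add: norm_power power_abs)

lemma Oc_of_real: "(\<lambda>t. complex_of_real (f t)) \<in> Oc k \<longleftrightarrow> f \<in> Or k"
  unfolding bigo_def by (simp add: norm_power power_abs)

lemma Re_Or:
  assumes "f \<in> Oc k" shows "(\<lambda>t. Re (f t)) \<in> Or k"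
proof -
  have "(\<lambda>t. Re (f t)) \<in> O[F](\<lambda>t. norm (f t))"
    by (rule bigoI[of _ 1]) (simp add: abs_Re_le_cmod)
  then show ?thesis using assms[unfolded Oc_iff_norm] by (rule landau_o.big.trans)
qed

lemma Im_Or:
  assumes "f \<in> Oc k" shows "(\<lambda>t. Im (f t)) \<in> Or k"
proof -
  have "(\<lambda>t. Im (f t)) \<in> O[F](\<lambda>t. norm (f t))"
    by (rule bigoI[of _ 1]) (simp add: abs_Im_le_cmod)
  then show ?thesis using assms[unfolded Oc_iff_norm] by (rule landau_o.big.trans)
qed

lemma e_power_weaken:
  assumes "l \<le> k" shows "(\<lambda>t. e t ^ k) \<in> Or l"
proof (rule bigoI[of _ 1])
  have "\<forall>\<^sub>F t in F. e t < 1"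
    using e_tendsto_0 by (rule order_tendstoD) simp
  with e_pos show "\<forall>\<^sub>F t in F. norm (e t ^ k) \<le> 1 * norm (e t ^ l)"
    by eventually_elim (use assms in \<open>simp add: power_decreasing\<close>)
qed

lemma Or_weaken: "f \<in> Or k \<Longrightarrow> l \<le> k \<Longrightarrow> f \<in> Or l"
  by (rule landau_o.big.trans[OF _ e_power_weaken])

lemma Oc_weaken: "f \<in> Oc k \<Longrightarrow> l \<le> k \<Longrightarrow> f \<in> Oc l"
  unfolding Oc_iff_norm by (rule Or_weaken)

lemma Oc_mult: "f \<in> Oc k \<Longrightarrow> g \<in> Oc l \<Longrightarrow> m \<le> k + l \<Longrightarrow> (\<lambda>t. f t * g t) \<in> Oc m"
  by (rule Oc_weaken[of _ "k + l"]) (simp_all add: power_add landau_o.big.mult)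

lemma Or_mult: "f \<in> Or k \<Longrightarrow> g \<in> Or l \<Longrightarrow> m \<le> k + l \<Longrightarrow> (\<lambda>t. f t * g t) \<in> Or m"
  by (rule Or_weaken[of _ "k + l"]) (simp_all add: power_add landau_o.big.mult)

lemma Oc_power: "f \<in> Oc 0 \<Longrightarrow> (\<lambda>t. f t ^ n) \<in> Oc 0"
  using landau_o.big_power[of f F "\<lambda>_. 1" n] by simp

lemma Oc_tendsto_0:
  assumes "f \<in> Oc k" "0 < k" shows "(f \<longlongrightarrow> 0) F"
proof -
  have "f \<in> Oc 1" using assms by (rule_tac Oc_weaken) auto
  then obtain c where "c > 0" and c: "\<forall>\<^sub>F t in F. norm (f t) \<le> c * norm (complex_of_real (e t) ^ 1)"
    by (elim landau_o.bigE)
  have "((\<lambda>t. c * norm (complex_of_real (e t) ^ 1)) \<longlongrightarrow> 0) F"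
    using tendsto_mult[OF tendsto_const tendsto_rabs[OF e_tendsto_0], of c] by simp
  from Lim_null_comparison[OF c this] show ?thesis .
qed

lemma esym_order:
  assumes "\<And>j. j < n \<Longrightarrow> (\<lambda>t. a t j) \<in> Oc 1"
  shows "(\<lambda>t. esym (a t) n m) \<in> Oc m"
  using assms
proof (induction n arbitrary: m)
  case 0
  then show ?case by (cases m) auto
next
  case (Suc n)
  show ?case
  proof (cases m)
    case (Suc l)
    show ?thesis unfolding Suc esym.simps
      by (intro sum_in_bigo(1) Suc.IH Suc.prems Oc_mult[of _ 1 _ l]) simp_all
  qed simp
qed

lemma beta_primitive_bounded:
  assumes "u \<in> Oc 0" shows "(\<lambda>t. beta_primitive n m (u t)) \<in> Oc 0"
  unfolding beta_primitive_def divide_inverse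
  by (intro big_sum_in_bigo Oc_mult[of _ 0 _ 0] sum_in_bigo Oc_power assms) simp_all

end

section \<open>Roots near sixth roots of unity that stay in the disk\<close>

text \<open>
  The constant $57 = 15 + 20 + 15 + 6 + 1$ is the sum of the binomial coefficients of the terms of
  order two and higher.
\<close>
lemma sixth_power_expansion:
  fixes u w :: complex
  assumes "norm w = 1" "norm (u - w) \<le> 1"
  shows "norm (u ^ 6 - w ^ 6 - 6 * w ^ 5 * (u - w)) \<le> 57 * norm (u - w) ^ 2"
proof -
  define d where "d = u - w"
  have nd: "norm d \<le> 1" using assms d_def by simp
  have eq: "u ^ 6 - w ^ 6 - 6 * w ^ 5 * (u - w)
    = d ^ 2 * (15 * w ^ 4 + 20 * w ^ 3 * d + 15 * w ^ 2 * d ^ 2 + 6 * w * d ^ 3 + d ^ 4)"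
    unfolding d_def by algebra
  have "norm (15 * w ^ 4 + 20 * w ^ 3 * d + 15 * w ^ 2 * d ^ 2 + 6 * w * d ^ 3 + d ^ 4)
     \<le> 15 + 20 * norm d + 15 * norm d ^ 2 + 6 * norm d ^ 3 + norm d ^ 4"
    by (intro norm_triangle_mono) (simp_all add: norm_mult norm_power assms)
  also have "\<dots> \<le> 15 + 20 * 1 + 15 * 1 + 6 * 1 + 1"
    using nd by (intro add_mono mult_left_mono power_le_one order.refl) auto
  finally have "norm (15 * w ^ 4 + 20 * w ^ 3 * d + 15 * w ^ 2 * d ^ 2 + 6 * w * d ^ 3 + d ^ 4) \<le> 57"
    by simp
  then have "norm (d ^ 2) * norm (15 * w ^ 4 + 20 * w ^ 3 * d + 15 * w ^ 2 * d ^ 2 + 6 * w * d ^ 3 + d ^ 4)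
    \<le> norm (d ^ 2) * 57"
    by (rule mult_left_mono) simp
  then show ?thesis unfolding eq norm_mult unfolding d_def[symmetric] by (simp add: norm_power)
qed

context small_parameter
begin

text \<open>
  Sixth roots of unity are simple, so a point near one of them is displaced by as much as its sixth
  power differs from $1$, and linearizing costs the square of that amount.
\<close>
lemma displacement_order:
  assumes w: "norm w = 1" "w ^ 6 = 1" and u: "(u \<longlongrightarrow> w) F" and k: "(\<lambda>t. (u t ^ 6 - 1) / 6) \<in> Oc k"
  shows "(\<lambda>t. u t - w) \<in> Oc k"
    and "(\<lambda>t. (u t ^ 6 - 1) / 6 - w ^ 5 * (u t - w)) \<in> Oc (2 * k)"
proof -
  have close: "\<forall>\<^sub>F t in F. norm (u t - w) < 1 / 57"
    using tendstoD[OF u, of "1/57"] by (simp add: dist_norm)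
  have "\<forall>\<^sub>F t in F. norm (u t - w) \<le> 2 * norm ((u t ^ 6 - 1) / 6)"
    using close
  proof eventually_elim
    case (elim t)
    have "norm (6 * w ^ 5 * (u t - w)) \<le> norm (u t ^ 6 - 1) + 57 * norm (u t - w) ^ 2"
      using sixth_power_expansion[of w "u t"] elim w
        norm_triangle_sub[of "6 * w ^ 5 * (u t - w)" "u t ^ 6 - 1"] by (simp add: norm_minus_commute)
    moreover have "57 * norm (u t - w) ^ 2 \<le> norm (u t - w)"
      using mult_right_mono[of "57 * norm (u t - w)" 1 "norm (u t - w)"] elim
      by (simp add: power2_eq_square)
    ultimately have "6 * norm (u t - w) \<le> norm (u t ^ 6 - 1) + norm (u t - w)"
      using w by (simp add: norm_mult norm_power)
    then have "3 * norm (u t - w) \<le> norm (u t ^ 6 - 1)"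
      using norm_ge_zero[of "u t - w"] by linarith
    then show ?case by (simp add: norm_divide)
  qed
  then have "(\<lambda>t. u t - w) \<in> O[F](\<lambda>t. (u t ^ 6 - 1) / 6)" by (rule bigoI)
  then show d: "(\<lambda>t. u t - w) \<in> Oc k" using k landau_o.big.trans by blast
  have "\<forall>\<^sub>F t in F. norm ((u t ^ 6 - 1) / 6 - w ^ 5 * (u t - w)) \<le> 57 * norm ((u t - w) * (u t - w))"
    using close
  proof eventually_elim
    case (elim t)
    have eq: "(u t ^ 6 - 1) / 6 - w ^ 5 * (u t - w) = (u t ^ 6 - w ^ 6 - 6 * w ^ 5 * (u t - w)) / 6"
      using w by (simp add: field_simps)
    have "norm (u t ^ 6 - w ^ 6 - 6 * w ^ 5 * (u t - w)) \<le> 57 * norm (u t - w) ^ 2"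
      using sixth_power_expansion[of w "u t"] elim w by simp
    then have "norm (u t ^ 6 - w ^ 6 - 6 * w ^ 5 * (u t - w)) / 6 \<le> 57 * norm (u t - w) ^ 2"
      using zero_le_power2[of "norm (u t - w)"] by linarith
    then show ?case
      by (simp only: eq norm_divide norm_mult power2_eq_square norm_numeral)
  qed
  then have "(\<lambda>t. (u t ^ 6 - 1) / 6 - w ^ 5 * (u t - w)) \<in> O[F](\<lambda>t. (u t - w) * (u t - w))"
    by (rule bigoI)
  also have "(\<lambda>t. (u t - w) * (u t - w)) \<in> Oc (2 * k)"
    by (rule Oc_mult[OF d d]) simp
  finally show "(\<lambda>t. (u t ^ 6 - 1) / 6 - w ^ 5 * (u t - w)) \<in> Oc (2 * k)" .
qed

lemma power_displacement:
  assumes "(\<lambda>t. u t - w) \<in> Oc k" "u \<in> Oc 0"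
  shows "(\<lambda>t. u t ^ n - w ^ n) \<in> Oc k"
proof (induction n)
  case (Suc n)
  have "(\<lambda>t. u t * (u t ^ n - w ^ n) + w ^ n * (u t - w)) \<in> Oc k"
    by (intro sum_in_bigo(1) Oc_mult[OF assms(2) Suc] Oc_mult[of _ 0, OF _ assms(1)]) simp_all
  also have "(\<lambda>t. u t * (u t ^ n - w ^ n) + w ^ n * (u t - w)) = (\<lambda>t. u t ^ Suc n - w ^ Suc n)"
    by (simp add: fun_eq_iff algebra_simps)
  finally show ?case .
qed simp

text \<open>
  A root near $w$ that stays in the disk of radius $1$ around $e^2$ cannot move outward by more than
  $e^2\,\mathrm{Re}\, w$. Since $w^5$ is the conjugate of $w$, the outward displacement is the real part
  of $w^5 (u - w)$, which is the linear part of $(u^6 - 1)/6$.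
\<close>
lemma outward_displacement:
  assumes w: "norm w = 1" "w ^ 6 = 1" and u: "(u \<longlongrightarrow> w) F"
    and disk: "\<forall>\<^sub>F t in F. norm (u t - of_real (e t ^ 2)) \<le> 1"
    and R: "\<forall>\<^sub>F t in F. (u t ^ 6 - 1) / 6 = R t" "R \<in> Oc k"
  shows "\<exists>h\<in>Or (2 * k). \<forall>\<^sub>F t in F. Re (R t) \<le> e t ^ 2 * Re w + h t"
proof
  have "(\<lambda>t. (u t ^ 6 - 1) / 6) \<in> Oc k"
    using R(2) unfolding landau_o.big.in_cong[OF R(1)] .
  from displacement_order(2)[OF w u this] Re_Or
  show "(\<lambda>t. Re ((u t ^ 6 - 1) / 6 - w ^ 5 * (u t - w))) \<in> Or (2 * k)" by blast
  have w5: "w ^ 5 = cnj w"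
  proof -
    have "w * cnj w = 1" using w by (simp add: complex_norm_square[symmetric])
    moreover have "w * w ^ 5 = 1" using w by (simp flip: power_Suc)
    ultimately show ?thesis by (metis mult.assoc mult.commute mult.right_neutral)
  qed
  show "\<forall>\<^sub>F t in F. Re (R t) \<le> e t ^ 2 * Re w + Re ((u t ^ 6 - 1) / 6 - w ^ 5 * (u t - w))"
    using disk R(1)
  proof eventually_elim
    case (elim t)
    have "Re (cnj w * (u t - of_real (e t ^ 2))) \<le> 1"
      using complex_Re_le_cmod[of "cnj w * (u t - of_real (e t ^ 2))"] elim w by (simp add: norm_mult)
    moreover have "Re (cnj w * w) = 1"
      using w complex_norm_square[of w] by (simp add: mult.commute)
    ultimately have "Re (cnj w * (u t - w)) \<le> e t ^ 2 * Re w"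
      by (simp add: algebra_simps)
    then show ?case unfolding w5 elim(2)[symmetric] minus_complex.sel(1)[of "(u t ^ 6 - 1) / 6"] by linarith
  qed
qed


lemma beta_primitive_displacement:
  assumes "(\<lambda>t. u t - w) \<in> Oc k" "u \<in> Oc 0"
  shows "(\<lambda>t. beta_primitive n m (u t) - beta_primitive n m w) \<in> Oc k"
proof -
  have "(\<lambda>t. beta_primitive n m (u t) - beta_primitive n m w)
    = (\<lambda>t. \<Sum>i\<le>m. (of_nat (m choose i) * (- 1) ^ i * inverse (of_nat (Suc (n - m + i))))
        * (u t ^ Suc (n - m + i) - w ^ Suc (n - m + i)))"
    unfolding beta_primitive_def sum_subtractf[symmetric]
    by (intro ext sum.cong refl) (simp add: divide_inverse algebra_simps)
  also have "\<dots> \<in> Oc k"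
    by (intro big_sum_in_bigo Oc_mult[of _ 0, OF _ power_displacement[OF assms]]) simp_all
  finally show ?thesis .
qed

lemma order_le_add:
  assumes "\<exists>h\<in>Or k. \<forall>\<^sub>F t in F. f t \<le> g t + h t" "d \<in> Or l" "l \<le> k"
  shows "\<exists>h\<in>Or l. \<forall>\<^sub>F t in F. f t + d t \<le> g t + h t"
proof -
  obtain h where h: "h \<in> Or k" "\<forall>\<^sub>F t in F. f t \<le> g t + h t" using assms(1) by blast
  have "(\<lambda>t. h t + d t) \<in> Or l"
    using sum_in_bigo(1)[OF Or_weaken[OF h(1) assms(3)] assms(2)] .
  moreover have "\<forall>\<^sub>F t in F. f t + d t \<le> g t + (h t + d t)"
    using h(2) by eventually_elim simp
  ultimately show ?thesis by (intro bexI[of _ "\<lambda>t. h t + d t"])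
qed

text \<open>
  The constraint of \<open>outward_displacement\<close>, written in the symmetric functions $s_1, s_2$ of the $a_j$
  and with the coefficients evaluated at $w$ itself. It is needed twice: with no knowledge of $s_1$
  beyond $O(e)$ it controls $s_1$ to first order, and once $s_1 = O(e^2)$ is known, the displacement is
  $O(e^2)$ as well, so that the same argument is accurate to $O(e^3)$.
\<close>
lemma
  assumes a: "\<And>j. j < 5 \<Longrightarrow> (\<lambda>t. a t j) \<in> Oc 1"
    and w: "norm w = 1" "w ^ 6 = 1"
    and disk: "\<forall>\<^sub>F t in F. norm (u t - of_real (e t ^ 2)) \<le> 1"
    and zero: "\<forall>\<^sub>F t in F. perturbed_primitive 5 (a t) (u t) = 0"
    and near: "\<forall>\<^sub>F t in F. norm (u t - w) ^ 5 \<le> 32 * norm (perturbed_primitive 5 (a t) w)"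
  shows first_order_condition:
      "\<exists>h\<in>Or 2. \<forall>\<^sub>F t in F. Re (esym (a t) 5 1 * beta_primitive 5 1 w) \<le> h t"
    and second_order_condition:
      "(\<lambda>t. esym (a t) 5 1) \<in> Oc 2 \<Longrightarrow>
       \<exists>h\<in>Or 3. \<forall>\<^sub>F t in F. Re (esym (a t) 5 1 * beta_primitive 5 1 w - esym (a t) 5 2 * beta_primitive 5 2 w)
                \<le> e t ^ 2 * Re w + h t"
proof -
  note esym = esym_order[of 5 a, OF a]
  define R where "R x t = esym (a t) 5 1 * beta_primitive 5 1 (x t) - esym (a t) 5 2 * beta_primitive 5 2 (x t)
        - (\<Sum>m\<in>{3..5}. (- 1) ^ m * esym (a t) 5 m * beta_primitive 5 m (x t))" for x t
  have tail: "(\<lambda>t. \<Sum>m\<in>{3..5}. (- 1) ^ m * esym (a t) 5 m * beta_primitive 5 m (x t)) \<in> Oc 3"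
    if "x \<in> Oc 0" for x
  proof (rule big_sum_in_bigo)
    fix m :: nat assume m: "m \<in> {3..5}"
    have "(\<lambda>t. esym (a t) 5 m * beta_primitive 5 m (x t)) \<in> Oc 3"
      by (rule Oc_mult[OF esym beta_primitive_bounded[OF that]]) (use m in auto)
    then show "(\<lambda>t. (- 1) ^ m * esym (a t) 5 m * beta_primitive 5 m (x t)) \<in> Oc 3"
      unfolding mult.assoc by simp
  qed
  have R_order: "R x \<in> Oc k" if "x \<in> Oc 0" "(\<lambda>t. esym (a t) 5 1) \<in> Oc k" "k \<le> 2" for x k
    unfolding R_def
  proof (intro sum_in_bigo(2))
    show "(\<lambda>t. esym (a t) 5 1 * beta_primitive 5 1 (x t)) \<in> Oc k"
      by (rule Oc_mult[OF that(2) beta_primitive_bounded[OF that(1)]]) simp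
    show "(\<lambda>t. esym (a t) 5 2 * beta_primitive 5 2 (x t)) \<in> Oc k"
      by (rule Oc_mult[OF esym beta_primitive_bounded[OF that(1)]]) (use that in simp_all)
  qed (rule Oc_weaken[OF tail], use that in simp_all)
  have R_1: "R x \<in> Oc 1" if "x \<in> Oc 0" for x
    using R_order[OF that esym] by simp

  \<comment> \<open>\<open>w\<close> is an approximate zero, so the hypothesis \<open>near\<close> makes the root converge to it.\<close>
  have "perturbed_primitive 5 (a t) w = - R (\<lambda>_. w) t" for t
    using w unfolding perturbed_primitive_5 R_def by simp
  moreover have "R (\<lambda>_. w) \<in> Oc 1" by (rule R_1) simp
  ultimately have "(\<lambda>t. perturbed_primitive 5 (a t) w) \<in> Oc 1" by simp
  then have "((\<lambda>t. 32 * norm (perturbed_primitive 5 (a t) w)) \<longlongrightarrow> 0) F"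
    by (intro tendsto_mult_right_zero tendsto_norm_zero Oc_tendsto_0[of _ 1]) simp_all
  then have "((\<lambda>t. norm (u t - w) ^ 5) \<longlongrightarrow> 0) F"
    using near by (intro Lim_null_comparison[where f = "\<lambda>t. norm (u t - w) ^ 5"]) simp_all
  then have "((\<lambda>t. root 5 (norm (u t - w) ^ 5)) \<longlongrightarrow> root 5 0) F"
    by (rule tendsto_real_root)
  then have u_tendsto: "(u \<longlongrightarrow> w) F"
    by (simp add: real_root_power_cancel tendsto_norm_zero_iff LIM_zero_iff)
  have u0: "u \<in> Oc 0"
    using u_tendsto by (intro bigoI_tendsto[where c = w]) simp_all
  have zero': "\<forall>\<^sub>F t in F. (u t ^ 6 - 1) / 6 = R u t"
    using zero by eventually_elim (simp add: perturbed_primitive_5 R_def)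

  \<comment> \<open>Replacing the moving root by \<open>w\<close> in the coefficients changes them by the displacement, which has
     the order \<open>k\<close> of \<open>s\<^sub>1\<close>. The error is the worst of this change times \<open>s\<^sub>1\<close> (order \<open>2k\<close>), this change
     times \<open>s\<^sub>2\<close> (order \<open>k + 2\<close>) and the tail (order 3).\<close>
  have freeze: "\<exists>h\<in>Or l. \<forall>\<^sub>F t in F.
        Re (esym (a t) 5 1 * beta_primitive 5 1 w - esym (a t) 5 2 * beta_primitive 5 2 w)
        \<le> e t ^ 2 * Re w + h t"
    if s: "(\<lambda>t. esym (a t) 5 1) \<in> Oc k" "k \<le> 2" "1 \<le> k" and l: "l \<le> 3" "l \<le> 2 * k" for k l
  proof -
    note Rk = R_order[OF u0 s(1,2)]
    have "(\<lambda>t. (u t ^ 6 - 1) / 6) \<in> Oc k"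
      using Rk unfolding landau_o.big.in_cong[OF zero'] .
    note beta = beta_primitive_displacement[OF displacement_order(1)[OF w u_tendsto this] u0]
    define D where "D t = esym (a t) 5 2 * (beta_primitive 5 2 (u t) - beta_primitive 5 2 w)
        + (\<Sum>m\<in>{3..5}. (- 1) ^ m * esym (a t) 5 m * beta_primitive 5 m (u t))
        - esym (a t) 5 1 * (beta_primitive 5 1 (u t) - beta_primitive 5 1 w)" for t
    have "D \<in> Oc l" unfolding D_def
    proof (intro sum_in_bigo)
      show "(\<lambda>t. esym (a t) 5 1 * (beta_primitive 5 1 (u t) - beta_primitive 5 1 w)) \<in> Oc l"
        by (rule Oc_mult[OF s(1) beta]) (use l in simp)
      show "(\<lambda>t. esym (a t) 5 2 * (beta_primitive 5 2 (u t) - beta_primitive 5 2 w)) \<in> Oc l"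
        by (rule Oc_mult[OF esym beta]) (use s l in simp_all)
    qed (rule Oc_weaken[OF tail[OF u0] l(1)])
    then have D: "(\<lambda>t. Re (D t)) \<in> Or l" by (rule Re_Or)
    have "Re (esym (a t) 5 1 * beta_primitive 5 1 w - esym (a t) 5 2 * beta_primitive 5 2 w)
        = Re (R u t) + Re (D t)" for t
      unfolding R_def D_def by (simp add: algebra_simps)
    with order_le_add[OF outward_displacement[OF w u_tendsto disk zero' Rk] D l(2)]
    show ?thesis by simp
  qed

  show "\<exists>h\<in>Or 3. \<forall>\<^sub>F t in F. Re (esym (a t) 5 1 * beta_primitive 5 1 w - esym (a t) 5 2 * beta_primitive 5 2 w)
                \<le> e t ^ 2 * Re w + h t" if "(\<lambda>t. esym (a t) 5 1) \<in> Oc 2"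
    using freeze[OF that, of 3] by simp

  have s2: "(\<lambda>t. Re (esym (a t) 5 2 * beta_primitive 5 2 w)) \<in> Or 2"
    by (intro Re_Or Oc_mult[OF esym beta_primitive_bounded]) simp_all
  obtain h where h: "h \<in> Or 2" "\<forall>\<^sub>F t in F.
      Re (esym (a t) 5 1 * beta_primitive 5 1 w - esym (a t) 5 2 * beta_primitive 5 2 w) \<le> e t ^ 2 * Re w + h t"
    using freeze[OF esym, of 2] by auto
  have "(\<lambda>t. e t ^ 2 * Re w) \<in> Or 2"
    by (rule Or_mult[of _ 2 _ 0]) simp_all
  then have "(\<lambda>t. e t ^ 2 * Re w + h t + Re (esym (a t) 5 2 * beta_primitive 5 2 w)) \<in> Or 2"
    using h(1) s2 by (intro sum_in_bigo)
  moreover have "\<forall>\<^sub>F t in F. Re (esym (a t) 5 1 * beta_primitive 5 1 w)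
      \<le> e t ^ 2 * Re w + h t + Re (esym (a t) 5 2 * beta_primitive 5 2 w)"
    using h(2) by eventually_elim simp
  ultimately show "\<exists>h\<in>Or 2. \<forall>\<^sub>F t in F. Re (esym (a t) 5 1 * beta_primitive 5 1 w) \<le> h t"
    by (intro bexI)
qed

end

section \<open>Incompatibility of the constraints\<close>

text \<open>
  The two bounds confine $1 + z$ to a thin sliver of a disk, of width $O(x)$ and hence of
  height $O(\sqrt x)$.
\<close>
lemma coefficient_size:
  assumes "0 < x" "x \<le> 1 / 100" "- 122 * x \<le> Re z" "norm (1 + z) \<le> 1 / (1 - 7 / 20 * x)"
  shows "2 * Re z + norm z ^ 2 \<le> 7 / 10 * x + x ^ 2" "\<bar>Re z\<bar> \<le> 122 * x" "norm z ^ 2 \<le> 18 ^ 2 * x"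
proof -
  have "1 \<le> (1 - 7 / 20 * x) ^ 2 * (1 + 7 / 10 * x + x ^ 2)"
  proof -
    have "(1 - 7 / 20 * x) ^ 2 * (1 + 7 / 10 * x + x ^ 2) - 1
       = x ^ 2 * (253 / 400 - 2457 / 4000 * x + 49 / 400 * x ^ 2)"
      by (simp add: power2_eq_square field_simps)
    moreover have "0 \<le> 253 / 400 - 2457 / 4000 * x + 49 / 400 * x ^ 2"
      using assms zero_le_power2[of x] by linarith
    ultimately show ?thesis using zero_le_power2[of x] mult_nonneg_nonneg by (smt (verit))
  qed
  then have "(1 / (1 - 7 / 20 * x)) ^ 2 \<le> 1 + 7 / 10 * x + x ^ 2"
    using assms by (simp add: power_divide divide_le_eq mult.commute)
  moreover have "norm (1 + z) ^ 2 \<le> (1 / (1 - 7 / 20 * x)) ^ 2"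
    using assms by (intro power_mono) simp_all
  moreover have "norm (1 + z) ^ 2 = 1 + 2 * Re z + norm z ^ 2"
    unfolding cmod_power2 by (simp add: power2_eq_square algebra_simps)
  ultimately show 1: "2 * Re z + norm z ^ 2 \<le> 7 / 10 * x + x ^ 2" by linarith
  have "x ^ 2 \<le> x" using assms by (simp add: power2_eq_square)
  with 1 assms zero_le_power2[of "norm z"]
  have "Re z \<le> 122 * x" and "norm z ^ 2 \<le> 324 * x" by linarith+
  with assms show "\<bar>Re z\<bar> \<le> 122 * x" "norm z ^ 2 \<le> 18 ^ 2 * x" by simp_all
qed

definition omega :: complex where "omega = Complex (- 1 / 2) (sqrt 3 / 2)"

context small_parameter
begin

lemma dominated_by_square_imp_bot:
  assumes "h \<in> Or 3" "\<forall>\<^sub>F t in F. c * e t ^ 2 \<le> h t" "0 < c"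
  shows "F = bot"
proof -
  obtain C where "C > 0" and C: "\<forall>\<^sub>F t in F. norm (h t) \<le> C * norm (e t ^ 3)"
    using assms(1) by (elim landau_o.bigE)
  have "\<forall>\<^sub>F t in F. e t < c / C"
    using e_tendsto_0 by (rule order_tendstoD) (use assms \<open>C > 0\<close> in simp)
  with C assms(2) e_pos have "\<forall>\<^sub>F t in F. False"
  proof eventually_elim
    case (elim t)
    have "c * e t ^ 2 \<le> C * norm (e t ^ 3)" using elim by simp
    also have "\<dots> = C * e t * e t ^ 2" using elim by (simp add: power3_eq_cube power2_eq_square)
    finally have "c * e t ^ 2 \<le> C * e t * e t ^ 2" .
    then have "c \<le> C * e t" using elim by simp
    then show False using elim \<open>C > 0\<close> by (simp add: field_simps)
  qed
  then show ?thesis by (simp add: trivial_limit_def)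
qed

text \<open>
  The linear programming argument. The constraints that are active at the optimum come from the roots
  near $-1$ and near the two primitive cube roots of unity, which is why these three occur.
\<close>
lemma no_uniformly_far_critical_points:
  assumes re: "\<forall>\<^sub>F t in F. \<forall>j<5. - 122 * e t ^ 2 \<le> Re (a t j)"
    and far: "\<forall>\<^sub>F t in F. \<forall>j<5. norm (1 + a t j) \<le> 1 / (1 - 7 / 20 * e t ^ 2)"
    and roots: "\<And>w. w ^ 6 = 1 \<Longrightarrow> 1 \<le> norm (w - 1) \<Longrightarrow> \<exists>u.
         (\<forall>\<^sub>F t in F. norm (u t - of_real (e t ^ 2)) \<le> 1)
       \<and> (\<forall>\<^sub>F t in F. perturbed_primitive 5 (a t) (u t) = 0)
       \<and> (\<forall>\<^sub>F t in F. norm (u t - w) ^ 5 \<le> 32 * norm (perturbed_primitive 5 (a t) w))"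
  shows "F = bot"
proof -
  have small: "\<forall>\<^sub>F t in F. e t < 1 / 10"
    using e_tendsto_0 by (rule order_tendstoD) simp
  have size: "\<forall>\<^sub>F t in F. \<forall>j<5. 2 * Re (a t j) + norm (a t j) ^ 2 \<le> 7 / 10 * e t ^ 2 + (e t ^ 2) ^ 2
      \<and> \<bar>Re (a t j)\<bar> \<le> 122 * e t ^ 2 \<and> norm (a t j) ^ 2 \<le> 18 ^ 2 * e t ^ 2"
    using e_pos small re far
  proof eventually_elim
    case (elim t)
    have "e t ^ 2 \<le> (1 / 10) ^ 2" using elim by (intro power_mono) simp_all
    then have "e t ^ 2 \<le> 1 / 100" by (simp add: power2_eq_square)
    with elim coefficient_size[of "e t ^ 2"] show ?case by simp
  qed
  have a: "(\<lambda>t. a t j) \<in> Oc 1" if "j < 5" for j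
  proof (rule bigoI[of _ 18])
    show "\<forall>\<^sub>F t in F. norm (a t j) \<le> 18 * norm (complex_of_real (e t) ^ 1)"
      using size e_pos
    proof eventually_elim
      case (elim t)
      then have "norm (a t j) ^ 2 \<le> (18 * e t) ^ 2" using that by (simp add: power_mult_distrib)
      then have "norm (a t j) \<le> 18 * e t" by (rule power2_le_imp_le) (use elim in simp)
      then show ?case using elim by simp
    qed
  qed
  have Re_a: "(\<lambda>t. Re (a t j)) \<in> Or 2" if "j < 5" for j
    by (rule bigoI[of _ 122]) (use size that in \<open>auto elim: eventually_mono\<close>)
  define s1 where "s1 t = esym (a t) 5 1" for t
  define s2 where "s2 t = esym (a t) 5 2" for t
  define B where "B t = (\<Sum>j<5. norm (a t j) ^ 2)" for t
  have Re_s1: "(\<lambda>t. Re (s1 t)) \<in> Or 2"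
    unfolding s1_def esym_1 Re_sum by (intro big_sum_in_bigo Re_a) simp

  have om6: "omega ^ 6 = 1" "omega ^ 4 = omega" "omega ^ 5 = cnj omega"
  proof -
    have o2: "omega ^ 2 = cnj omega"
      by (simp add: omega_def complex_eq_iff power2_eq_square)
    have o3: "cnj omega * omega = 1" by (simp add: omega_def complex_eq_iff)
    have "omega ^ 3 = 1" using o2 o3 by (simp add: power3_eq_cube power2_eq_square mult.assoc)
    moreover have "omega ^ 6 = omega ^ 3 * omega ^ 3" "omega ^ 4 = omega ^ 3 * omega" "omega ^ 5 = omega ^ 3 * omega ^ 2"
      by (simp_all flip: power_add power_Suc2)
    ultimately show "omega ^ 6 = 1" "omega ^ 4 = omega" "omega ^ 5 = cnj omega" by (simp_all add: o2)
  qed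
  have beta_omega: "beta_primitive 5 1 omega = (cnj omega - 1) / 5"
     "beta_primitive 5 2 omega = (omega - 1) / 4 - 2 * (cnj omega - 1) / 5"
    using beta_primitive_5_1[OF om6(1)] beta_primitive_5_2[OF om6(1)] unfolding om6 by simp_all
  have cnj6: "cnj omega ^ 6 = 1" "cnj omega ^ 4 = cnj omega" "cnj omega ^ 5 = omega"
    unfolding complex_cnj_power[symmetric] om6 by simp_all
  have beta_cnj: "beta_primitive 5 1 (cnj omega) = (omega - 1) / 5"
     "beta_primitive 5 2 (cnj omega) = (cnj omega - 1) / 4 - 2 * (omega - 1) / 5"
    using beta_primitive_5_1[OF cnj6(1)] beta_primitive_5_2[OF cnj6(1)] unfolding cnj6 by simp_all
  have beta_minus_1: "beta_primitive 5 1 (- 1) = - 2 / 5" "beta_primitive 5 2 (- 1) = 4 / 5"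
    using beta_primitive_5_1[of "- 1"] beta_primitive_5_2[of "- 1"] by simp_all
  have neq1: "1 \<le> norm (omega - 1)" "1 \<le> norm (cnj omega - 1)"
    by (simp_all add: omega_def cmod_def power2_eq_square)
  have norm_root: "norm w = 1" if "w ^ 6 = 1" for w :: complex
    using that by (metis norm_power norm_one power_eq_1_iff zero_neq_numeral norm_ge_zero)

  have first: "\<exists>h\<in>Or 2. \<forall>\<^sub>F t in F. Re (s1 t * beta_primitive 5 1 w) \<le> h t"
    if w: "w ^ 6 = 1" "1 \<le> norm (w - 1)" for w
  proof -
    from roots[OF w] obtain u where u: "\<forall>\<^sub>F t in F. norm (u t - of_real (e t ^ 2)) \<le> 1"
      "\<forall>\<^sub>F t in F. perturbed_primitive 5 (a t) (u t) = 0"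
      "\<forall>\<^sub>F t in F. norm (u t - w) ^ 5 \<le> 32 * norm (perturbed_primitive 5 (a t) w)" by blast
    show ?thesis unfolding s1_def
      by (rule first_order_condition[OF a norm_root[OF w(1)] w(1) u])
  qed
  obtain h1 where h1: "h1 \<in> Or 2" "\<forall>\<^sub>F t in F. Re (s1 t * beta_primitive 5 1 omega) \<le> h1 t"
    using first[OF om6(1) neq1(1)] by blast
  obtain h2 where h2: "h2 \<in> Or 2" "\<forall>\<^sub>F t in F. Re (s1 t * beta_primitive 5 1 (cnj omega)) \<le> h2 t"
    using first[OF cnj6(1) neq1(2)] by blast
  \<comment> \<open>The imaginary part of \<open>s\<^sub>1\<close> enters the constraints at the two cube roots of unity with opposite
     signs, so it is bounded from both sides.\<close>
  have Im_s1: "(\<lambda>t. Im (s1 t)) \<in> Or 2"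
  proof -
    have "(\<lambda>t. \<bar>h1 t\<bar> + \<bar>h2 t\<bar> + \<bar>Re (s1 t)\<bar>) \<in> Or 2"
      using h1 h2 Re_s1 by (intro sum_in_bigo) simp_all
    moreover have "\<forall>\<^sub>F t in F. norm (Im (s1 t)) \<le> 10 * norm (\<bar>h1 t\<bar> + \<bar>h2 t\<bar> + \<bar>Re (s1 t)\<bar>)"
      using h1(2) h2(2)
    proof eventually_elim
      case (elim t)
      have "- 3 / 10 * Re (s1 t) + sqrt 3 / 10 * Im (s1 t) \<le> h1 t"
        "- 3 / 10 * Re (s1 t) - sqrt 3 / 10 * Im (s1 t) \<le> h2 t"
        using elim unfolding beta_omega beta_cnj by (simp_all add: omega_def field_simps)
      then have "\<bar>sqrt 3 / 10 * Im (s1 t)\<bar> \<le> \<bar>h1 t\<bar> + \<bar>h2 t\<bar> + \<bar>Re (s1 t)\<bar>" by linarith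
      moreover have "1 / 10 * \<bar>Im (s1 t)\<bar> \<le> sqrt 3 / 10 * \<bar>Im (s1 t)\<bar>"
        by (intro mult_right_mono) simp_all
      ultimately show ?case by (simp add: abs_mult)
    qed
    ultimately show ?thesis by (rule landau_o.big.trans[OF bigoI, rotated])
  qed
  have s1: "s1 \<in> Oc 2"
  proof -
    have "(\<lambda>t. of_real (Re (s1 t)) + \<i> * of_real (Im (s1 t))) \<in> Oc 2"
      using Re_s1 Im_s1 by (intro sum_in_bigo) (simp_all add: Oc_of_real)
    then show ?thesis by (simp add: complex_eq[symmetric])
  qed

  have second: "\<exists>h\<in>Or 3. \<forall>\<^sub>F t in F. Re (s1 t * beta_primitive 5 1 w - s2 t * beta_primitive 5 2 w)
       \<le> e t ^ 2 * Re w + h t"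
    if w: "w ^ 6 = 1" "1 \<le> norm (w - 1)" for w
  proof -
    from roots[OF w] obtain u where u: "\<forall>\<^sub>F t in F. norm (u t - of_real (e t ^ 2)) \<le> 1"
      "\<forall>\<^sub>F t in F. perturbed_primitive 5 (a t) (u t) = 0"
      "\<forall>\<^sub>F t in F. norm (u t - w) ^ 5 \<le> 32 * norm (perturbed_primitive 5 (a t) w)" by blast
    show ?thesis unfolding s1_def s2_def
      by (rule second_order_condition[OF a norm_root[OF w(1)] w(1) u s1[unfolded s1_def]])
  qed
  obtain k0 where k0: "k0 \<in> Or 3" "\<forall>\<^sub>F t in F.
      Re (s1 t * beta_primitive 5 1 (-1) - s2 t * beta_primitive 5 2 (-1)) \<le> e t ^ 2 * Re (-1) + k0 t"
    using second[of "-1"] by auto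
  obtain k1 where k1: "k1 \<in> Or 3" "\<forall>\<^sub>F t in F.
      Re (s1 t * beta_primitive 5 1 omega - s2 t * beta_primitive 5 2 omega) \<le> e t ^ 2 * Re omega + k1 t"
    using second[OF om6(1) neq1(1)] by blast
  obtain k2 where k2: "k2 \<in> Or 3" "\<forall>\<^sub>F t in F.
      Re (s1 t * beta_primitive 5 1 (cnj omega) - s2 t * beta_primitive 5 2 (cnj omega))
       \<le> e t ^ 2 * Re (cnj omega) + k2 t"
    using second[OF cnj6(1) neq1(2)] by blast

  define d where "d t = 2 * Re (s2 t) - B t" for t
  \<comment> \<open>By Newton's identity, \<open>2s\<^sub>2\<close> is the square of \<open>s\<^sub>1\<close> minus the sum of the squares of the \<open>a\<^sub>j\<close>. These are
     nearly imaginary, so their squares are nearly the negatives of their squared moduli.\<close>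
  have d: "d \<in> Or 3"
  proof -
    have sq: "(a t j)\<^sup>2 + of_real (norm (a t j) ^ 2) = 2 * of_real (Re (a t j)) * a t j" for t j
    proof -
      have "(a t j)\<^sup>2 + of_real (norm (a t j) ^ 2) = a t j * (a t j + cnj (a t j))"
        unfolding complex_norm_square by (simp add: power2_eq_square algebra_simps)
      then show ?thesis by (simp add: complex_add_cnj)
    qed
    have "d t = Re (s1 t * s1 t - (\<Sum>j<5. 2 * of_real (Re (a t j)) * a t j))" for t
    proof -
      have "2 * s2 t - of_real (B t) = s1 t * s1 t - (\<Sum>j<5. (a t j)\<^sup>2 + of_real (norm (a t j) ^ 2))"
        unfolding s2_def s1_def esym_2 esym_1 B_def of_real_sum sum.distrib by (simp add: power2_eq_square)
      moreover have "d t = Re (2 * s2 t - of_real (B t))" by (simp add: d_def)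
      ultimately show ?thesis unfolding sq by simp
    qed
    moreover have "(\<lambda>t. s1 t * s1 t - (\<Sum>j<5. 2 * of_real (Re (a t j)) * a t j)) \<in> Oc 3"
    proof (intro sum_in_bigo big_sum_in_bigo)
      show "(\<lambda>t. s1 t * s1 t) \<in> Oc 3" by (rule Oc_mult[OF s1 s1]) simp
      show "(\<lambda>t. 2 * of_real (Re (a t j)) * a t j) \<in> Oc 3" if "j \<in> {..<5}" for j
        by (rule Oc_mult[of _ 2 _ 1]) (use that Re_a a Oc_of_real in simp_all)
    qed
    ultimately show ?thesis using Re_Or[of "\<lambda>t. s1 t * s1 t - (\<Sum>j<5. 2 * of_real (Re (a t j)) * a t j)" 3] by presburger
  qed

  \<comment> \<open>The multipliers 1 and 8/3 of the constraints at \<open>-1\<close> and at the cube roots of unity are the dual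
     solution; \<open>1/6 = 11/3 - 7/2\<close> is the resulting gap.\<close>
  have "(\<lambda>t. e t ^ 4) \<in> Or 3" by (rule e_power_weaken) simp
  then have "(\<lambda>t. k0 t + 8 / 3 * k1 t + 8 / 3 * k2 t + 5 * e t ^ 4 + d t) \<in> Or 3"
    using k0(1) k1(1) k2(1) d by (intro sum_in_bigo) simp_all
  moreover have "\<forall>\<^sub>F t in F. 1 / 6 * e t ^ 2 \<le> k0 t + 8 / 3 * k1 t + 8 / 3 * k2 t + 5 * e t ^ 4 + d t"
    using k0(2) k1(2) k2(2) size
  proof eventually_elim
    case (elim t)
    have "(\<Sum>j<5. 2 * Re (a t j) + norm (a t j) ^ 2) \<le> (\<Sum>j<5::nat. 7 / 10 * e t ^ 2 + e t ^ 4)"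
      using elim(4) by (intro sum_mono) simp
    then have top: "2 * Re (s1 t) + B t \<le> 7 / 2 * e t ^ 2 + 5 * e t ^ 4"
      unfolding s1_def esym_1 B_def Re_sum sum.distrib sum_distrib_left by simp
    have "- 2 / 5 * Re (s1 t) - 4 / 5 * Re (s2 t) \<le> - (e t ^ 2) + k0 t"
      using elim(1) unfolding beta_minus_1 by simp
    moreover have "- 3 / 5 * Re (s1 t) - 9 / 20 * Re (s2 t) \<le> - (e t ^ 2) + k1 t + k2 t"
      using elim(2,3) unfolding beta_omega beta_cnj by (simp add: omega_def field_simps)
    ultimately show ?case using top unfolding d_def by linarith
  qed
  ultimately show ?thesis by (rule dominated_by_square_imp_bot) simp
qed

end

section \<open>Reciprocal distances of the critical points of a sextic\<close>

lemma pderiv_mult_linear: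
  fixes p :: "complex poly"
  shows "pderiv ([:- c, 1:] * p) = p + [:- c, 1:] * pderiv p"
  by (simp only: pderiv_mult) (simp add: pderiv_pCons)

lemma pderiv_prod_linear:
  fixes z :: "nat \<Rightarrow> complex"
  assumes "\<And>j. j < n \<Longrightarrow> x \<noteq> z j"
  shows "poly (pderiv (\<Prod>j<n. [:- z j, 1:])) x = (\<Prod>j<n. x - z j) * (\<Sum>j<n. 1 / (x - z j))"
  using assms
proof (induction n)
  case (Suc n)
  then have "x - z n \<noteq> 0" by auto
  have "poly (pderiv (\<Prod>j<Suc n. [:- z j, 1:])) x
     = (\<Prod>j<n. x - z j) + (x - z n) * poly (pderiv (\<Prod>j<n. [:- z j, 1:])) x"
    unfolding prod.lessThan_Suc mult.commute[of _ "[:- z n, 1:]"] pderiv_mult_linear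
    by (simp add: poly_prod left_diff_distrib)
  also have "\<dots> = (\<Prod>j<n. x - z j) + (x - z n) * ((\<Prod>j<n. x - z j) * (\<Sum>j<n. 1 / (x - z j)))"
    using Suc by simp
  also have "\<dots> = (\<Prod>j<Suc n. x - z j) * (\<Sum>j<Suc n. 1 / (x - z j))"
    unfolding prod.lessThan_Suc sum.lessThan_Suc using \<open>x - z n \<noteq> 0\<close> by (simp add: distrib_left)
  finally show ?case .
qed simp

lemma exists_power_le_prod:
  fixes f :: "nat \<Rightarrow> real"
  assumes "0 < n" "\<And>k. 0 \<le> f k"
  shows "\<exists>k<n. f k ^ n \<le> (\<Prod>k<n. f k)"
proof -
  obtain k where k: "k < n" "\<And>l. l < n \<Longrightarrow> f k \<le> f l"
    using ex_min_if_finite[of "f ` {..<n}"] assms(1) by (force simp: not_less)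
  have "(\<Prod>l<n. f k) \<le> (\<Prod>l<n. f l)"
    using k assms(2) by (intro prod_mono) auto
  with k show ?thesis by auto
qed

lemma prod_le_factor_times_bound:
  fixes f :: "nat \<Rightarrow> real"
  assumes "k < n" "\<And>l. l < n \<Longrightarrow> 0 \<le> f l" "\<And>l. l < n \<Longrightarrow> f l \<le> c"
  shows "(\<Prod>l<n. f l) \<le> f k * c ^ (n - 1)"
proof -
  have "(\<Prod>l<n. f l) = f k * (\<Prod>l\<in>{..<n} - {k}. f l)"
    using assms by (simp add: prod.remove)
  also have "(\<Prod>l\<in>{..<n} - {k}. f l) \<le> (\<Prod>l\<in>{..<n} - {k}. c)"
    using assms by (intro prod_mono) auto
  finally show ?thesis using assms by (simp add: mult_left_mono)
qed

text \<open>
  A polynomial with a simple root $b$, its other roots $u_k$ and its critical points $\eta_j$ are tied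
  together by their distances from $b$. With $Q = (X - b) R$ one has $Q'(b) = R(b)$ and
  $Q''(b) = 2 R'(b)$: the first identity relates the products of the distances, the quotient of both
  relates the sums of the reciprocals.
\<close>
lemma factorization_at_root:
  fixes Q :: "complex poly"
  assumes deg: "degree Q = Suc n" and root: "poly Q b = 0" and simple: "poly (pderiv Q) b \<noteq> 0"
  obtains d u \<eta> where
    "Q = [:- b, 1:] * smult d (\<Prod>k<n. [:- u k, 1:])" "d \<noteq> 0"
    "pderiv Q = smult (of_nat (Suc n) * d) (\<Prod>j<n. [:- \<eta> j, 1:])"
    "(\<Prod>k<n. b - u k) = of_nat (Suc n) * (\<Prod>j<n. b - \<eta> j)"
    "(\<Sum>j<n. 1 / (b - \<eta> j)) = 2 * (\<Sum>k<n. 1 / (b - u k))"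
    "\<forall>j<n. \<eta> j \<noteq> b"
proof -
  have Q0: "Q \<noteq> 0" using deg by auto
  obtain R where R: "Q = [:- b, 1:] * R" using root by (auto simp: poly_eq_0_iff_dvd)
  with Q0 have R0: "R \<noteq> 0" by auto
  have degR: "degree R = n"
    using deg R0 unfolding R by (subst (asm) degree_mult_eq) auto
  obtain u where u: "smult (lead_coeff R) (\<Prod>k<degree R. [:- u k, 1:]) = R"
    using complex_poly_decompose' .
  obtain \<eta> where \<eta>: "smult (lead_coeff (pderiv Q)) (\<Prod>j<degree (pderiv Q). [:- \<eta> j, 1:]) = pderiv Q"
    using complex_poly_decompose' .
  define d where "d = lead_coeff R"
  have d0: "d \<noteq> 0" using R0 d_def by simp
  have deg': "degree (pderiv Q) = n" using deg by (simp add: degree_pderiv)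
  have "coeff Q (Suc n) = d"
    using deg lead_coeff_mult[of "[:- b, 1:]" R] unfolding R[symmetric] d_def by simp
  then have lc: "lead_coeff (pderiv Q) = of_nat (Suc n) * d"
    unfolding deg' by (simp add: coeff_pderiv)
  have Rd: "R = smult d (\<Prod>k<n. [:- u k, 1:])" using u degR d_def by simp
  have Qd: "pderiv Q = smult (of_nat (Suc n) * d) (\<Prod>j<n. [:- \<eta> j, 1:])"
    using \<eta> unfolding deg' lc[unfolded deg'] by simp
  have dQ: "pderiv Q = R + [:- b, 1:] * pderiv R"
    unfolding R by (rule pderiv_mult_linear)
  then have v1: "poly (pderiv Q) b = poly R b" by simp
  have ddQ: "poly (pderiv (pderiv Q)) b = 2 * poly (pderiv R) b"
    unfolding dQ pderiv_add pderiv_mult_linear by simp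
  have R1: "poly R b = d * (\<Prod>k<n. b - u k)" by (simp add: Rd poly_prod)
  have Q1: "poly (pderiv Q) b = of_nat (Suc n) * d * (\<Prod>j<n. b - \<eta> j)" by (simp add: Qd poly_prod)
  have u1: "b \<noteq> u k" if "k < n" for k using simple that unfolding v1 R1 by auto
  have \<eta>1: "b \<noteq> \<eta> j" if "j < n" for j using simple that unfolding Q1 by auto
  have "poly (pderiv (pderiv Q)) b = poly (pderiv Q) b * (\<Sum>j<n. 1 / (b - \<eta> j))"
    unfolding Q1 by (subst Qd) (simp add: pderiv_smult pderiv_prod_linear \<eta>1)
  moreover have "poly (pderiv R) b = poly R b * (\<Sum>k<n. 1 / (b - u k))"
    unfolding R1 by (subst Rd) (simp add: pderiv_smult pderiv_prod_linear u1)
  ultimately have "(\<Sum>j<n. 1 / (b - \<eta> j)) = 2 * (\<Sum>k<n. 1 / (b - u k))"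
    using simple unfolding ddQ v1 by simp
  moreover have "(\<Prod>k<n. b - u k) = of_nat (Suc n) * (\<Prod>j<n. b - \<eta> j)"
    using d0 v1 unfolding R1 Q1 by simp
  ultimately show thesis
    using that[of d u \<eta>] R Rd Qd d0 \<eta>1 by metis
qed

text \<open>
  In the coordinates $1/(1 - \eta_j) = 1 + a_j$ the linear factor $(x - \eta_j)/(1 - \eta_j)$ becomes
  $x - a_j (1 - x)$, so both sides are primitives of the same function that vanish at $1$.
\<close>
lemma perturbed_primitive_eq:
  fixes Q :: "complex poly"
  assumes Q': "pderiv Q = smult c (\<Prod>j<n. [:- \<eta> j, 1:])" and root: "poly Q 1 = 0"
    and \<eta>: "\<And>j. j < n \<Longrightarrow> \<eta> j \<noteq> 1"
  shows "poly Q x = poly (pderiv Q) 1 * perturbed_primitive n (\<lambda>j. 1 / (1 - \<eta> j) - 1) x"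
proof -
  let ?a = "\<lambda>j. 1 / (1 - \<eta> j) - 1" and ?K = "poly (pderiv Q) 1"
  define f where "f x = poly Q x - ?K * perturbed_primitive n ?a x" for x
  have "(f has_field_derivative 0) (at x)" for x
  proof -
    have "x - ?a j * (1 - x) = (x - \<eta> j) / (1 - \<eta> j)" if "j < n" for j
      using \<eta>[OF that] by (simp add: field_simps)
    then have "(\<Prod>j<n. x - ?a j * (1 - x)) = (\<Prod>j<n. x - \<eta> j) / (\<Prod>j<n. 1 - \<eta> j)"
      by (simp add: prod_dividef)
    moreover have "1 - \<eta> j \<noteq> 0" if "j < n" for j using \<eta>[OF that] by simp
    then have "(\<Prod>j<n. 1 - \<eta> j) \<noteq> 0" by (simp add: prod_zero_iff)
    ultimately have "?K * (\<Prod>j<n. x - ?a j * (1 - x)) = poly (pderiv Q) x"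
      by (simp add: Q' poly_prod)
    then have "((\<lambda>x. ?K * perturbed_primitive n ?a x) has_field_derivative poly (pderiv Q) x) (at x)"
      using DERIV_cmult[OF perturbed_primitive_deriv] by metis
    from DERIV_diff[OF poly_DERIV[of Q x] this] show ?thesis unfolding f_def by simp
  qed
  then have "\<forall>x. (f has_field_derivative 0) (at x)" by blast
  then have "f x = f 1" using has_field_derivative_zero_constant[of UNIV f] by auto
  then show ?thesis by (simp add: f_def root)
qed

text \<open>
  The unit disk is mapped by $u \mapsto 1/(1 - u)$ to the half plane of real part at least $1/2$. The
  disk here is shifted across the pole by $x$, which costs $O(x)$ away from the pole.
\<close>
lemma Re_inverse_lower:
  fixes u :: complex and x :: real
  assumes x: "0 < x" "x \<le> 1 / 100" and u: "norm (u - of_real x) \<le> 1" and far: "3 / 10 \<le> norm (1 - u)"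
  shows "1 / 2 - 23 / 2 * x \<le> Re (1 / (1 - u))"
proof -
  define w where "w = 1 - u"
  have N: "(3 / 10) ^ 2 \<le> norm w ^ 2" using far unfolding w_def by (intro power_mono) auto
  have "norm (u - of_real x) ^ 2 \<le> 1" using u by (simp add: power_le_one)
  moreover have "norm (u - of_real x) ^ 2 = (1 - x) ^ 2 - 2 * (1 - x) * Re w + norm w ^ 2"
    unfolding cmod_power2 w_def by (simp add: power2_eq_square algebra_simps)
  moreover have "(1 - x) ^ 2 = 1 - 2 * x + x ^ 2" by (simp add: power2_eq_square algebra_simps)
  ultimately have 1: "norm w ^ 2 - 2 * x \<le> 2 * (1 - x) * Re w"
    using zero_le_power2[of x] by linarith
  have "2 * x \<le> 23 * x * (3 / 10) ^ 2" using x by (simp add: power2_eq_square)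
  also have "\<dots> \<le> 23 * x * norm w ^ 2" using N x by (intro mult_left_mono) auto
  finally have 2: "norm w ^ 2 * (1 - 23 * x) \<le> 2 * (1 - x) * Re w" using 1 by (simp add: algebra_simps)
  have "0 \<le> norm w ^ 2 * (1 - 23 * x)" using x by (intro mult_nonneg_nonneg) auto
  with 2 have "0 \<le> 2 * (1 - x) * Re w" by linarith
  then have "0 \<le> Re w" using x by (simp add: zero_le_mult_iff)
  then have "0 \<le> x * Re w" using x by simp
  with 2 have "norm w ^ 2 * (1 - 23 * x) \<le> 2 * Re w" by (simp add: algebra_simps)
  moreover have "0 < norm w ^ 2" using N by (rule less_le_trans[rotated]) simp
  ultimately have "1 - 23 * x \<le> 2 * Re w / norm w ^ 2"
    by (simp only: pos_le_divide_eq mult.commute)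
  moreover have "Re (1 / w) = Re w / norm w ^ 2"
    by (simp add: Re_divide cmod_power2)
  ultimately show ?thesis unfolding w_def[symmetric] by simp
qed

text \<open>
  The data extracted from a sextic whose critical points are all far from its root at $1 - x$, after a
  translation by $x$. The last part says that every sixth root of unity other than $1$ is close to some
  root, in a crude sense that \<open>first_order_condition\<close> and \<open>second_order_condition\<close> then refine.
\<close>
lemma sextic_critical_coefficients:
  assumes x: "0 < x" "x \<le> 1 / 100"
    and P: "P \<in> S 6 (1 - x)" and far: "1 - 7 / 20 * x < crit_dist (1 - x) P"
  shows "\<exists>a. (\<forall>j<5. - 122 * x \<le> Re (a j)) \<and> (\<forall>j<5. norm (1 + a j) \<le> 1 / (1 - 7 / 20 * x))
    \<and> (\<forall>w. w ^ 6 = 1 \<longrightarrow> 1 \<le> norm (w - 1) \<longrightarrow> (\<exists>u. norm (u - of_real x) \<le> 1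
        \<and> perturbed_primitive 5 a u = 0 \<and> norm (u - w) ^ 5 \<le> 32 * norm (perturbed_primitive 5 a w)))"
proof -
  define \<rho> where "\<rho> = 1 - 7 / 20 * x"
  have \<rho>: "0.99 \<le> \<rho>" "\<rho> \<le> 1" using x by (simp_all add: \<rho>_def)
  define Q where "Q = pcompose P [:- of_real x, 1:]"
  have Qp: "poly Q z = poly P (z - of_real x)" for z by (simp add: Q_def poly_pcompose)
  have Qd: "poly (pderiv Q) z = poly (pderiv P) (z - of_real x)" for z
    by (simp add: Q_def poly_pcompose pderiv_pcompose pderiv_pCons)
  have deg: "degree Q = Suc 5" using P by (simp add: Q_def S_def degree_pcompose)
  have root: "poly Q 1 = 0" using P by (simp add: Qp S_def)
  have disk: "norm (u - of_real x) \<le> 1" if "poly Q u = 0" for u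
    using P that unfolding Qp S_def by blast
  have crit: "\<rho> \<le> norm (1 - \<eta>)" if "poly (pderiv Q) \<eta> = 0" for \<eta>
  proof -
    have "crit_dist (1 - x) P \<le> dist (complex_of_real (1 - x)) (\<eta> - of_real x)"
      unfolding crit_dist_def by (rule infdist_le) (use that Qd in simp)
    with far show ?thesis unfolding \<rho>_def dist_norm by (simp add: algebra_simps)
  qed
  have simple: "poly (pderiv Q) 1 \<noteq> 0" using crit[of 1] \<rho> by auto
  obtain d and u \<eta> :: "nat \<Rightarrow> complex" where f: "Q = [:- 1, 1:] * smult d (\<Prod>k<5. [:- u k, 1:])" "d \<noteq> 0"
    "pderiv Q = smult (of_nat (Suc 5) * d) (\<Prod>j<5. [:- \<eta> j, 1:])"
    "(\<Prod>k<5. 1 - u k) = of_nat (Suc 5) * (\<Prod>j<5. 1 - \<eta> j)"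
    "(\<Sum>j<5. 1 / (1 - \<eta> j)) = 2 * (\<Sum>k<5. 1 / (1 - u k))"
    "\<forall>j<5. \<eta> j \<noteq> 1"
    by (rule factorization_at_root[OF deg root simple])
  define a where "a j = 1 / (1 - \<eta> j) - 1" for j
  have Qa: "poly Q z = poly (pderiv Q) 1 * perturbed_primitive 5 a z" for z
    unfolding a_def by (rule perturbed_primitive_eq[OF f(3) root f(6)[rule_format]])
  have Q_roots: "poly Q (u k) = 0" if "k < 5" for k
    using that by (subst f(1)) (auto simp: poly_prod)
  have \<eta>_far: "\<rho> \<le> norm (1 - \<eta> j)" if "j < 5" for j
    by (rule crit, subst f(3)) (use that in \<open>auto simp: poly_prod\<close>)
  have norm_a: "norm (1 + a j) \<le> 1 / \<rho>" if "j < 5" for j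
    using \<eta>_far[OF that] \<rho> by (simp add: a_def norm_divide frac_le)
  have u_le: "norm (1 - u k) \<le> 2" if "k < 5" for k
  proof -
    have "norm (of_real (1 - x) - (u k - of_real x)) \<le> norm (complex_of_real (1 - x)) + norm (u k - of_real x)"
      by (rule norm_triangle_ineq4)
    then show ?thesis using disk[OF Q_roots[OF that]] x by (simp only: norm_of_real) simp
  qed
  have prods: "6 * (\<Prod>j<5. norm (1 - \<eta> j)) = (\<Prod>k<5. norm (1 - u k))"
    using f(4) by (simp add: prod_norm norm_mult)
  \<comment> \<open>No other root is close to 1, since the product of the distances of the roots from 1 is six times
     the product of the distances of the critical points.\<close>
  have u_ge: "3 / 10 \<le> norm (1 - u k)" if "k < 5" for k
  proof -
    have "6 * 0.95 \<le> 6 * \<rho> ^ 5"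
      using power_mono[of "0.99" \<rho> 5] \<rho> by (simp add: power_divide)
    also have "\<rho> ^ 5 \<le> (\<Prod>j<5. norm (1 - \<eta> j))"
      using prod_mono[of "{..<5}" "\<lambda>_. \<rho>" "\<lambda>j. norm (1 - \<eta> j)"] \<eta>_far \<rho> by simp
    also have "6 * \<dots> = (\<Prod>k<5. norm (1 - u k))" by (rule prods)
    also have "\<dots> \<le> norm (1 - u k) * 2 ^ (5 - 1)"
      using that u_le by (intro prod_le_factor_times_bound) auto
    finally show ?thesis by simp
  qed
  have Re_a_le: "Re (1 + a j) \<le> 1 + x" if "j < 5" for j
  proof -
    have "Re (1 + a j) \<le> 1 / \<rho>" using norm_a[OF that] complex_Re_le_cmod order_trans by blast
    also have "\<dots> \<le> 1 + x"
    proof -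
      have "(1 + x) * \<rho> = 1 + x * (13 / 20 - 7 / 20 * x)" by (simp add: \<rho>_def field_simps)
      also have "1 \<le> \<dots>" using x by simp
      finally show ?thesis using \<rho> by (simp add: divide_le_eq)
    qed
    finally show ?thesis .
  qed
  \<comment> \<open>Five terms have a sum of at least \<open>5 - O(x)\<close> and each is at most \<open>1 + O(x)\<close>; therefore none is
     much smaller than 1.\<close>
  have "(\<Sum>k<5::nat. 1 / 2 - 23 / 2 * x) \<le> (\<Sum>k<5. Re (1 / (1 - u k)))"
    using Re_inverse_lower[OF x disk[OF Q_roots] u_ge] by (intro sum_mono) auto
  also have "2 * \<dots> = Re (\<Sum>j<5. 1 / (1 - \<eta> j))" unfolding f(5) by simp
  also have "\<dots> = (\<Sum>j<5. Re (1 + a j))" by (simp add: a_def)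
  finally have sum_Re: "5 - 115 * x \<le> (\<Sum>j<5. Re (1 + a j))" by simp
  have Re_a: "- 122 * x \<le> Re (a j)" if "j < 5" for j
  proof -
    have "(\<Sum>j<5. Re (1 + a j)) = Re (1 + a j) + (\<Sum>i\<in>{..<5} - {j}. Re (1 + a i))"
      using that by (simp add: sum.remove)
    also have "(\<Sum>i\<in>{..<5} - {j}. Re (1 + a i)) \<le> (\<Sum>i\<in>{..<5} - {j}. 1 + x)"
      using Re_a_le by (intro sum_mono) auto
    also have "\<dots> = 4 * (1 + x)" using that by simp
    finally have "5 - 115 * x \<le> Re (1 + a j) + 4 * (1 + x)" using sum_Re by linarith
    then show ?thesis using x by simp
  qed
  have near: "\<exists>v. norm (v - of_real x) \<le> 1 \<and> perturbed_primitive 5 a v = 0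
       \<and> norm (v - w) ^ 5 \<le> 32 * norm (perturbed_primitive 5 a w)"
    if w: "1 \<le> norm (w - 1)" for w
  proof -
    obtain k where k: "k < 5" "norm (w - u k) ^ 5 \<le> (\<Prod>k<5. norm (w - u k))"
      using exists_power_le_prod[of 5 "\<lambda>k. norm (w - u k)"] by auto
    have "norm (poly (pderiv Q) 1) = norm d * (\<Prod>k<5. norm (1 - u k))"
      by (subst f(3)) (simp add: poly_prod norm_mult prod_norm[symmetric] prods[symmetric])
    also have "\<dots> \<le> norm d * (\<Prod>k<5::nat. 2)"
      using u_le by (intro mult_left_mono prod_mono) auto
    finally have K: "norm (poly (pderiv Q) 1) \<le> 32 * norm d" by simp
    have "norm d * norm (w - u k) ^ 5 \<le> norm (w - 1) * (norm d * (\<Prod>k<5. norm (w - u k)))"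
      using mult_mono[OF w mult_left_mono[OF k(2), of "norm d"]] by simp
    also have "\<dots> = norm (poly Q w)"
    proof -
      have "poly Q w = (w - 1) * (d * (\<Prod>k<5. w - u k))"
        by (subst f(1)) (simp add: poly_prod algebra_simps)
      then show ?thesis by (simp only: norm_mult prod_norm)
    qed
    also have "\<dots> \<le> 32 * norm d * norm (perturbed_primitive 5 a w)"
      unfolding Qa norm_mult using K by (intro mult_right_mono) auto
    finally have "norm (w - u k) ^ 5 \<le> 32 * norm (perturbed_primitive 5 a w)"
      using f(2) by (simp add: mult.assoc mult.left_commute)
    moreover have "perturbed_primitive 5 a (u k) = 0"
      using Qa[of "u k"] Q_roots[OF k(1)] simple by simp
    ultimately show ?thesis using disk[OF Q_roots[OF k(1)]]
      by (intro exI[of _ "u k"]) (simp add: norm_minus_commute[of "u k" w])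
  qed
  show ?thesis using Re_a norm_a near unfolding \<rho>_def by (intro exI[of _ a]) blast
qed

section \<open>A quartic with far critical points\<close>

lemma norm_root_real_quadratic:
  fixes B C :: real and z :: complex
  assumes "z ^ 2 + of_real B * z + of_real C = 0" and "B ^ 2 < 4 * C"
  shows "Re z = - B / 2" "norm z ^ 2 = C"
proof -
  have re: "Re z ^ 2 - Im z ^ 2 + B * Re z + C = 0" and im: "Im z * (2 * Re z + B) = 0"
    using assms(1) unfolding complex_eq_iff
    by (simp_all add: power2_eq_square algebra_simps)
  have "Im z \<noteq> 0"
  proof
    assume "Im z = 0"
    with re have "(2 * Re z + B) ^ 2 + (4 * C - B ^ 2) = 0" by (simp add: power2_eq_square algebra_simps)
    with assms(2) show False using zero_le_power2[of "2 * Re z + B"] by linarith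
  qed
  with im show 1: "Re z = - B / 2" by simp
  with re show "norm z ^ 2 = C" unfolding cmod_power2 1 by (simp add: power2_eq_square field_simps)
qed

text \<open>
  The polynomial $(z - 1 + x)(z + 1)(z^2 + pz + 1)$ has all its roots but one on the unit circle. The
  parameter $p$ is chosen so that $-2x/3$ is a critical point, at distance $1 - x/3$. The other two
  critical points then form a conjugate pair, and their distance from $1 - x$ is read off from the
  quadratic factor of the derivative: it is $1 - x/3 + O(x^2)$ as well.
\<close>
lemma quartic_witness:
  fixes x :: real
  assumes x: "0 < x" "x \<le> 1 / 100"
  shows "\<exists>P\<in>S 4 (1 - x). 1 - 17 / 50 * x \<le> crit_dist (1 - x) P"
proof -
  define p where "p = (x - 4 / 3 * x ^ 2 + 4 / 27 * x ^ 3) / (1 - x)"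
  have px: "p * (1 - x) = x - 4 / 3 * x ^ 2 + 4 / 27 * x ^ 3" using x by (simp add: p_def)
  have x3: "0 \<le> x ^ 3" "x ^ 3 \<le> x ^ 2 / 100" "0 \<le> x ^ 2" "x ^ 2 \<le> x / 100"
    using x by (simp_all add: power3_eq_cube power2_eq_square)
  have p0: "0 \<le> p" unfolding p_def using x x3 by (intro divide_nonneg_nonneg) linarith+
  have "p * (1 - x) \<le> x - x ^ 2" unfolding px using x3 by linarith
  also have "\<dots> = x * (1 - x)" by (simp add: power2_eq_square algebra_simps)
  finally have "p * (1 - x) \<le> x * (1 - x)" .
  then have p1: "p \<le> x" using x by simp
  define B where "B = 3 / 4 * p + x / 12"
  define C where "C = x / 2 - x ^ 2 / 18"
  define P where "P = [:- complex_of_real (1 - x), 1:] * [:1, 1:] * [:1, of_real p, 1:]"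
  have P: "poly P z = (z - of_real (1 - x)) * (z + 1) * (z ^ 2 + of_real p * z + of_real 1)" for z
    by (simp add: P_def power2_eq_square algebra_simps)
  have P': "poly (pderiv P) z = 4 * (z + of_real (2 / 3 * x)) * (z ^ 2 + of_real B * z + of_real C)" for z
  proof -
    have "poly (pderiv P) z = 4 * z ^ 3 + 3 * of_real (p + x) * z ^ 2 + 2 * of_real (x * (1 + p)) * z
            + of_real (x - p * (1 - x))"
      unfolding P_def by (simp add: pderiv_pCons power2_eq_square power3_eq_cube algebra_simps)
    moreover have "x - p * (1 - x) = 8 / 3 * x * C"
      unfolding px C_def by (simp add: power2_eq_square power3_eq_cube algebra_simps)
    moreover have "3 * (p + x) = 4 * (B + 2 / 3 * x)" "2 * (x * (1 + p)) = 4 * (C + 2 / 3 * x * B)"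
      unfolding B_def C_def by (simp_all add: power2_eq_square algebra_simps)
    ultimately have "poly (pderiv P) z = 4 * z ^ 3 + of_real (4 * (B + 2 / 3 * x)) * z ^ 2
       + of_real (4 * (C + 2 / 3 * x * B)) * z + of_real (8 / 3 * x * C)"
      by (metis of_real_mult of_real_numeral)
    then show ?thesis by (simp add: power2_eq_square power3_eq_cube algebra_simps)
  qed
  have "P \<in> S 4 (1 - x)"
    unfolding S_def
  proof (intro CollectI conjI allI impI)
    show "degree P = 4" unfolding P_def by (subst degree_mult_eq | simp)+
    show "poly P (complex_of_real (1 - x)) = 0" by (simp add: P)
    fix z assume "poly P z = 0"
    then consider "z = of_real (1 - x)" | "z = - 1" | "z ^ 2 + of_real p * z + of_real 1 = 0"
      unfolding P by (auto simp: add_eq_0_iff2)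
    then show "norm z \<le> 1"
    proof cases
      case 3
      have "p ^ 2 \<le> 1 ^ 2" using p0 p1 x by (intro power_mono) auto
      with norm_root_real_quadratic(2)[OF 3] show ?thesis by (simp add: abs_square_eq_1 power2_eq_1_iff)
    qed (use x in \<open>simp_all only: norm_of_real, simp_all\<close>)
  qed
  moreover have "1 - 17 / 50 * x \<le> crit_dist (1 - x) P"
  proof -
    have far: "1 - 17 / 50 * x \<le> dist (complex_of_real (1 - x)) z" if z: "poly (pderiv P) z = 0" for z
    proof -
      have "z + of_real (2 / 3 * x) = 0 \<or> z ^ 2 + of_real B * z + of_real C = 0"
        using z unfolding P' by (metis mult_eq_0_iff zero_neq_numeral)
      then consider "z = - of_real (2 / 3 * x)" | "z ^ 2 + of_real B * z + of_real C = 0"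
        unfolding eq_neg_iff_add_eq_0 by blast
      then show ?thesis
      proof cases
        case 1
        have "dist (complex_of_real (1 - x)) z = norm (complex_of_real (1 - x / 3))"
          unfolding dist_norm 1 by (rule arg_cong[where f = norm]) simp
        then show ?thesis using x by (simp only: norm_of_real)
      next
        case 2
        have "B ^ 2 \<le> x ^ 2" unfolding B_def using p0 p1 x by (intro power_mono) auto
        moreover have "4 * C = 2 * x - 2 / 9 * x ^ 2" unfolding C_def by simp
        ultimately have "B ^ 2 < 4 * C" using x x3 by linarith
        note q = norm_root_real_quadratic[OF 2 this]
        have "dist (complex_of_real (1 - x)) z ^ 2 = (1 - x) ^ 2 - 2 * (1 - x) * Re z + norm z ^ 2"
          unfolding dist_norm cmod_power2 by (simp add: power2_eq_square algebra_simps)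
        also have "\<dots> = (1 - x) ^ 2 + 3 / 4 * (p * (1 - x)) + (1 - x) * x / 12 + C"
          unfolding q B_def by (simp add: field_simps)
        also have "\<dots> = 1 - 2 / 3 * x - 5 / 36 * x ^ 2 + x ^ 3 / 9"
          unfolding px C_def by (simp add: power2_eq_square power3_eq_cube field_simps)
        also have "\<dots> \<ge> 1 - 17 / 25 * x + 289 / 2500 * x ^ 2" using x3 x by linarith
        also have "1 - 17 / 25 * x + 289 / 2500 * x ^ 2 = (1 - 17 / 50 * x) ^ 2"
          by (simp add: power2_eq_square field_simps)
        finally show ?thesis by (rule power2_le_imp_le) simp
      qed
    qed
    have "poly (pderiv P) (- of_real (2 / 3 * x)) = 0" unfolding P' by simp
    then have "{z. poly (pderiv P) z = 0} \<noteq> {}" by blast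
    then show ?thesis unfolding crit_dist_def infdist_def using far by (auto intro!: cINF_greatest)
  qed
  ultimately show ?thesis by blast
qed

section \<open>Comparison of the two radii\<close>

text \<open>
  Needed for the supremum to be an upper bound. The product of the distances of the critical points
  from $\beta$ is at most that of the distances of the other roots, each of which is at most $2$.
\<close>
lemma crit_dist_le_2:
  assumes \<beta>: "0 \<le> \<beta>" "\<beta> \<le> 1" and n: "0 < n" and P: "P \<in> S (Suc n) \<beta>"
  shows "crit_dist \<beta> P \<le> 2"
proof (cases "poly (pderiv P) (of_real \<beta>) = 0")
  case True
  then show ?thesis by (simp add: crit_dist_def infdist_zero)
next
  case False
  have deg: "degree P = Suc n" and root: "poly P (of_real \<beta>) = 0"
    and disk: "\<And>z. poly P z = 0 \<Longrightarrow> norm z \<le> 1" using P by (auto simp: S_def)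
  obtain d and u \<eta> :: "nat \<Rightarrow> complex" where f:
    "P = [:- of_real \<beta>, 1:] * smult d (\<Prod>k<n. [:- u k, 1:])" "d \<noteq> 0"
    "pderiv P = smult (of_nat (Suc n) * d) (\<Prod>j<n. [:- \<eta> j, 1:])"
    "(\<Prod>k<n. of_real \<beta> - u k) = of_nat (Suc n) * (\<Prod>j<n. of_real \<beta> - \<eta> j)"
    "(\<Sum>j<n. 1 / (of_real \<beta> - \<eta> j)) = 2 * (\<Sum>k<n. 1 / (of_real \<beta> - u k))"
    "\<forall>j<n. \<eta> j \<noteq> of_real \<beta>"
    by (rule factorization_at_root[OF deg root False])
  obtain j where j: "j < n" "norm (of_real \<beta> - \<eta> j) ^ n \<le> (\<Prod>j<n. norm (of_real \<beta> - \<eta> j))"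
    using exists_power_le_prod[OF n, of "\<lambda>j. norm (of_real \<beta> - \<eta> j)"] by auto
  have "norm (of_real \<beta> - u k) \<le> 2" if "k < n" for k
  proof -
    have "poly P (u k) = 0" by (subst f(1)) (use that in \<open>auto simp: poly_prod\<close>)
    from disk[OF this] show ?thesis
      using norm_triangle_ineq4[of "complex_of_real \<beta>" "u k"] \<beta> by simp
  qed
  then have "(\<Prod>k<n. norm (of_real \<beta> - u k)) \<le> (\<Prod>k<n. 2)" by (intro prod_mono) auto
  moreover have "(\<Prod>k<n. norm (of_real \<beta> - u k)) = real (Suc n) * (\<Prod>j<n. norm (of_real \<beta> - \<eta> j))"
    unfolding prod_norm f(4) norm_mult by (simp only: norm_of_nat)
  moreover have "1 * (\<Prod>j<n. norm (of_real \<beta> - \<eta> j)) \<le> real (Suc n) * (\<Prod>j<n. norm (of_real \<beta> - \<eta> j))"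
    by (intro mult_right_mono prod_nonneg) auto
  ultimately have "norm (of_real \<beta> - \<eta> j) ^ n \<le> 2 ^ n" using j(2) by simp
  then have "norm (of_real \<beta> - \<eta> j) \<le> 2" using n by (simp add: power_mono_iff)
  moreover have "poly (pderiv P) (\<eta> j) = 0" by (subst f(3)) (use j in \<open>auto simp: poly_prod\<close>)
  then have "crit_dist \<beta> P \<le> dist (of_real \<beta>) (\<eta> j)"
    unfolding crit_dist_def by (intro infdist_le) simp
  ultimately show ?thesis unfolding dist_norm by simp
qed

text \<open>
  The parameters at which the bound fails, with a choice of a counterexample for each of them, give a
  filter to which \<open>no_uniformly_far_critical_points\<close> applies. That filter is therefore trivial, which
  means that the bound holds eventually.
\<close>
lemma eventually_sextic_upper:
  "\<forall>\<^sub>F \<beta> in at_left (1::real). \<forall>P\<in>S 6 \<beta>. crit_dist \<beta> P \<le> 1 - 7 / 20 * (1 - \<beta>)"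
proof -
  define bad where "bad = {\<beta>. \<exists>P\<in>S 6 \<beta>. 1 - 7 / 20 * (1 - \<beta>) < crit_dist \<beta> P}"
  define F where "F = inf (at_left 1) (principal bad)"
  have F_le: "F \<le> at_left 1" unfolding F_def by simp
  have near_1: "\<forall>\<^sub>F \<beta> in at_left (1::real). 99 / 100 < \<beta>"
    by (rule eventually_at_left_real[of "99 / 100" 1, THEN eventually_mono]) auto
  have lt_1: "\<forall>\<^sub>F \<beta> in at_left (1::real). \<beta> < 1" by (rule eventually_at_left_real[of 0 1, THEN eventually_mono]) auto
  have F_props: "\<forall>\<^sub>F \<beta> in F. 99 / 100 < \<beta> \<and> \<beta> < 1 \<and> \<beta> \<in> bad"
    unfolding F_def eventually_inf_principal using near_1 lt_1 by eventually_elim simp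
  have "((\<lambda>\<beta>. sqrt (1 - \<beta>)) \<longlongrightarrow> sqrt (1 - 1)) (at_left (1::real))" by (intro tendsto_intros)
  then interpret small_parameter F "\<lambda>\<beta>. sqrt (1 - \<beta>)"
    using tendsto_mono[OF F_le] F_props by unfold_locales (auto elim: eventually_mono)
  define ok where "ok \<beta> a \<longleftrightarrow> (\<forall>j<5. - 122 * (1 - \<beta>) \<le> Re (a j))
      \<and> (\<forall>j<5. norm (1 + a j) \<le> 1 / (1 - 7 / 20 * (1 - \<beta>)))
      \<and> (\<forall>w. w ^ 6 = 1 \<longrightarrow> 1 \<le> norm (w - 1) \<longrightarrow> (\<exists>u. norm (u - of_real (1 - \<beta>)) \<le> 1
        \<and> perturbed_primitive 5 a u = 0 \<and> norm (u - w) ^ 5 \<le> 32 * norm (perturbed_primitive 5 a w)))"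
    for \<beta> a
  define a where "a \<beta> = (SOME a. ok \<beta> a)" for \<beta>
  have ok: "\<forall>\<^sub>F \<beta> in F. \<beta> < 1 \<and> ok \<beta> (a \<beta>)"
    using F_props
  proof eventually_elim
    case (elim \<beta>)
    then obtain P where P: "P \<in> S 6 (1 - (1 - \<beta>))" "1 - 7 / 20 * (1 - \<beta>) < crit_dist (1 - (1 - \<beta>)) P"
      unfolding bad_def by auto
    have "\<exists>a. ok \<beta> a" unfolding ok_def by (rule sextic_critical_coefficients[OF _ _ P]) (use elim in simp_all)
    with elim show ?case unfolding a_def by (simp add: someI_ex)
  qed
  have "F = bot"
  proof (rule no_uniformly_far_critical_points[of a])
    show "\<forall>\<^sub>F \<beta> in F. \<forall>j<5. - 122 * (sqrt (1 - \<beta>))\<^sup>2 \<le> Re (a \<beta> j)"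
      using ok by eventually_elim (simp add: ok_def)
    show "\<forall>\<^sub>F \<beta> in F. \<forall>j<5. norm (1 + a \<beta> j) \<le> 1 / (1 - 7 / 20 * (sqrt (1 - \<beta>))\<^sup>2)"
      using ok by eventually_elim (simp add: ok_def)
    fix w :: complex assume w: "w ^ 6 = 1" "1 \<le> norm (w - 1)"
    define near where "near \<beta> u \<longleftrightarrow> norm (u - of_real (1 - \<beta>)) \<le> 1 \<and> perturbed_primitive 5 (a \<beta>) u = 0
       \<and> norm (u - w) ^ 5 \<le> 32 * norm (perturbed_primitive 5 (a \<beta>) w)" for \<beta> u
    define u where "u \<beta> = (SOME u. near \<beta> u)" for \<beta>
    have "\<forall>\<^sub>F \<beta> in F. \<beta> < 1 \<and> near \<beta> (u \<beta>)"
      using ok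
    proof eventually_elim
      case (elim \<beta>)
      then have "\<exists>u. near \<beta> u" using w unfolding ok_def near_def by blast
      with elim show ?case unfolding u_def by (simp add: someI_ex)
    qed
    then show "\<exists>u. (\<forall>\<^sub>F \<beta> in F. norm (u \<beta> - of_real ((sqrt (1 - \<beta>))\<^sup>2)) \<le> 1)
       \<and> (\<forall>\<^sub>F \<beta> in F. perturbed_primitive 5 (a \<beta>) (u \<beta>) = 0)
       \<and> (\<forall>\<^sub>F \<beta> in F. norm (u \<beta> - w) ^ 5 \<le> 32 * norm (perturbed_primitive 5 (a \<beta>) w))"
      by (intro exI[of _ u] conjI; elim eventually_mono) (simp_all add: near_def)
  qed
  then have "\<forall>\<^sub>F \<beta> in at_left 1. \<beta> \<notin> bad"
    unfolding F_def trivial_limit_def[symmetric] by (simp add: trivial_limit_def eventually_inf_principal)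
  then show ?thesis by eventually_elim (auto simp: bad_def not_less)
qed

theorem corollary4:
  shows "\<forall>\<^sub>F \<beta> in at_left (1::real). r 6 \<beta> < r 4 \<beta>"
proof -
  have "\<forall>\<^sub>F \<beta> in at_left (1::real). \<beta> \<in> {99 / 100<..<1}"
    by (rule eventually_at_left_real) simp
  with eventually_sextic_upper show ?thesis
  proof eventually_elim
    case (elim \<beta>)
    have "[:- complex_of_real \<beta>, 1:] ^ 6 \<in> S 6 \<beta>"
      using elim by (auto simp: S_def degree_linear_power poly_power)
    then have "r 6 \<beta> \<le> 1 - 7 / 20 * (1 - \<beta>)"
      unfolding r_def using elim by (intro cSUP_least) auto
    also have "\<dots> < 1 - 17 / 50 * (1 - \<beta>)" using elim by simp
    also obtain P where P: "P \<in> S 4 \<beta>" "1 - 17 / 50 * (1 - \<beta>) \<le> crit_dist \<beta> P"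
      using quartic_witness[of "1 - \<beta>"] elim by auto
    note P(2)
    also have "crit_dist \<beta> P \<le> r 4 \<beta>"
      unfolding r_def
    proof (rule cSUP_upper[OF P(1)])
      show "bdd_above (crit_dist \<beta> ` S 4 \<beta>)"
        using crit_dist_le_2[of \<beta> 3] elim by (auto intro!: bdd_aboveI[of _ 2])
    qed
    finally show ?case .
  qed
qed

end
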